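(* Let $n\ge 1$ and $\gamma\ge 1$ be integers such that $\mathbb{G}_{n,\gamma}$ is nonempty. If $G\in\mathbb{G}_{n,\gamma}$ attains the minimum spectral radius among all graphs in $\mathbb{G}_{n,\gamma}$, then $G$ is a tree.
   Context: All graphs are simple, finite, undirected. A dominating set of a graph $G$ is a set $D\subseteq V(G)$ such that every vertex of $V(G)\setminus D$ is adjacent to a vertex of $D$; the domination number $\gamma(G)$ is the minimum cardinality of a dominating set. $\mathbb{G}_{n,\gamma}$ denotes the set of simple connected graphs on $n$ vertices with domination number $\gamma$. The spectral radius $\rho(G)$ is the largest eigenvalue of the adjacency matrix of $G$. *)

theory Defs
  imports "Graph_Theory.Graph_Theory" "Jordan_Normal_Form.Char_Poly"
begin

text \<open>
  Finite simple undirected graphs are represented by the locale predicate \<^const>\<open>pair_graph\<close>: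
  an undirected edge \<open>uv\<close> is the pair of arcs \<open>(u,v)\<close> and \<open>(v,u)\<close>.
\<close>

text \<open>
  In this representation every edge yields a directed cycle \<open>u \<rightarrow> v \<rightarrow> u\<close> of length 2, so that
  \<^const>\<open>tree\<close> fails for every graph with an edge. The cycles of the undirected
  graph are the directed cycles of length at least 3.
\<close>

definition undirected_tree :: "'a pair_pre_digraph \<Rightarrow> bool" where
  "undirected_tree G \<longleftrightarrow>
     Digraph_Component.connected (with_proj G) \<and>
     \<not> (\<exists>p. pre_digraph.cycle (with_proj G) p \<and> 3 \<le> length p)"

definition dominating_set :: "'a pair_pre_digraph \<Rightarrow> 'a set \<Rightarrow> bool" where
  "dominating_set G D \<longleftrightarrow>
     D \<subseteq> pverts G \<and> (\<forall>v \<in> pverts G - D. \<exists>u \<in> D. (u, v) \<in> parcs G)"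

definition domination_number :: "'a pair_pre_digraph \<Rightarrow> nat" where
  "domination_number G = Min (card ` {D. dominating_set G D})"

definition connected_graphs :: "nat \<Rightarrow> nat \<Rightarrow> 'a pair_pre_digraph set" where
  "connected_graphs n g =
     {G. pair_graph G \<and> Digraph_Component.connected (with_proj G) \<and>
         card (pverts G) = n \<and> domination_number G = g}"

definition adjacency_matrix :: "'a pair_pre_digraph \<Rightarrow> 'a list \<Rightarrow> real mat" where
  "adjacency_matrix G vs =
     mat (length vs) (length vs) (\<lambda>(i, j). if (vs ! i, vs ! j) \<in> parcs G then 1 else 0)"

text \<open>
  Matrices are indexed by initial segments of the naturals, so the vertices are enumerated by an
  arbitrarily chosen list; \<open>eigenvalue_adjacency_matrix_indep\<close> below shows that the choice is
  irrelevant.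
\<close>

definition vertex_list :: "'a set \<Rightarrow> 'a list" where
  "vertex_list V = (SOME vs. distinct vs \<and> set vs = V)"

text \<open>
  The adjacency matrix is real symmetric, so all of its eigenvalues are real and the maximum over
  the real eigenvalues is the largest eigenvalue.
\<close>

definition graph_spectral_radius :: "'a pair_pre_digraph \<Rightarrow> real" where
  "graph_spectral_radius G = Max {k. eigenvalue (adjacency_matrix G (vertex_list (pverts G))) k}"

lemma vertex_list:
  assumes "finite V"
  shows "distinct (vertex_list V)" "set (vertex_list V) = V"
  using someI_ex[of "\<lambda>vs. distinct vs \<and> set vs = V"] finite_distinct_list[OF assms]
  unfolding vertex_list_def by blast+

lemma eigenvalue_adjacency_matrix_iff:
  assumes "distinct vs"
  shows "eigenvalue (adjacency_matrix G vs) k \<longleftrightarrow>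
    (\<exists>x. (\<exists>v\<in>set vs. x v \<noteq> 0) \<and>
         (\<forall>v\<in>set vs. (\<Sum>u\<in>set vs. if (v, u) \<in> parcs G then x u else 0) = k * x v))"
    (is "?L \<longleftrightarrow> ?R")
proof -
  let ?n = "length vs" and ?A = "adjacency_matrix G vs"
  have bij: "bij_betw ((!) vs) {0..<?n} (set vs)"
    using bij_betw_nth[OF assms, of "{..<?n}" "set vs"] by (simp add: atLeast0LessThan)
  have mult: "(?A *\<^sub>v w) $ i =
      (\<Sum>u\<in>set vs. if (vs ! i, u) \<in> parcs G then x u else 0)"
    if "w \<in> carrier_vec ?n" "i < ?n" "\<And>j. j < ?n \<Longrightarrow> w $ j = x (vs ! j)" for w x i
  proof -
    have "(?A *\<^sub>v w) $ i = (\<Sum>j\<in>{0..<?n}. if (vs ! i, vs ! j) \<in> parcs G then x (vs ! j) else 0)"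
      using that by (auto simp: adjacency_matrix_def scalar_prod_def intro!: sum.cong)
    also have "\<dots> = (\<Sum>u\<in>set vs. if (vs ! i, u) \<in> parcs G then x u else 0)"
      by (rule sum.reindex_bij_betw[OF bij])
    finally show ?thesis .
  qed
  have dims: "dim_row ?A = ?n" "dim_col ?A = ?n" by (simp_all add: adjacency_matrix_def)
  show ?thesis
  proof
    assume ?L
    then obtain w where w: "w \<in> carrier_vec ?n" "w \<noteq> 0\<^sub>v ?n" "?A *\<^sub>v w = k \<cdot>\<^sub>v w"
      unfolding eigenvalue_def eigenvector_def dims by blast
    define x where "x v = w $ (the_inv_into {0..<?n} ((!) vs) v)" for v
    have x: "w $ j = x (vs ! j)" if "j < ?n" for j
      using that bij by (simp add: x_def the_inv_into_f_f bij_betw_def)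
    have "\<exists>i<?n. w $ i \<noteq> 0" using w(1,2) by (auto simp: vec_eq_iff)
    then have 1: "\<exists>v\<in>set vs. x v \<noteq> 0" using x by (metis nth_mem)
    have "(\<Sum>u\<in>set vs. if (v, u) \<in> parcs G then x u else 0) = k * x v" if v: "v \<in> set vs" for v
    proof -
      obtain i where i: "i < ?n" "v = vs ! i" using v by (auto simp: in_set_conv_nth)
      have "(?A *\<^sub>v w) $ i = k * x v" using w i x by simp
      then show ?thesis using mult[OF w(1) i(1) x] i by simp
    qed
    with 1 show ?R by blast
  next
    assume ?R
    then obtain x where x: "\<exists>v\<in>set vs. x v \<noteq> 0"
      "\<And>v. v \<in> set vs \<Longrightarrow> (\<Sum>u\<in>set vs. if (v, u) \<in> parcs G then x u else 0) = k * x v"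
      by blast
    define w where "w = vec ?n (\<lambda>i. x (vs ! i))"
    have w: "w \<in> carrier_vec ?n" "\<And>j. j < ?n \<Longrightarrow> w $ j = x (vs ! j)" by (auto simp: w_def)
    have "w \<noteq> 0\<^sub>v ?n"
    proof
      assume 0: "w = 0\<^sub>v ?n"
      obtain v where "v \<in> set vs" "x v \<noteq> 0" using x(1) by blast
      then obtain i where "i < ?n" "x (vs ! i) \<noteq> 0" by (auto simp: in_set_conv_nth)
      then show False using w(2)[of i] 0 by simp
    qed
    moreover have "?A *\<^sub>v w = k \<cdot>\<^sub>v w"
    proof (rule eq_vecI)
      fix i assume "i < dim_vec (k \<cdot>\<^sub>v w)"
      then have i: "i < ?n" using w(1) by auto
      show "(?A *\<^sub>v w) $ i = (k \<cdot>\<^sub>v w) $ i"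
        using mult[OF w(1) i w(2)] x(2)[of "vs ! i"] i w by simp
    qed (use w dims in simp)
    ultimately show ?L using w unfolding eigenvalue_def eigenvector_def dims by blast
  qed
qed

lemma eigenvalue_adjacency_matrix_indep:
  assumes "distinct vs" "distinct ws" "set vs = set ws"
  shows "eigenvalue (adjacency_matrix G vs) k \<longleftrightarrow> eigenvalue (adjacency_matrix G ws) k"
  using assms by (simp add: eigenvalue_adjacency_matrix_iff)

end

theory Submission
  imports Defs "HOL-Analysis.Function_Topology"
begin

text \<open>
  Suppose that \<open>G\<close> contains a cycle and let \<open>D\<close> be a minimum dominating set. Joining each vertex
  outside \<open>D\<close> to one neighbour in \<open>D\<close> gives a spanning forest of stars, so some edge \<open>e\<close> of the cycle
  lies outside this forest. Then \<open>G - e\<close> is connected and still dominated by \<open>D\<close>, hence has the same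
  domination number, while deleting an edge of a connected graph strictly decreases the spectral
  radius.
\<close>

section \<open>Rayleigh quotients\<close>

text \<open>Functions on vertices play the part of vectors, so no enumeration of \<open>V\<close>
  enters the optimisation argument.\<close>

definition quadratic_form :: "('a \<Rightarrow> 'a \<Rightarrow> real) \<Rightarrow> 'a set \<Rightarrow> ('a \<Rightarrow> real) \<Rightarrow> real" where
  "quadratic_form a V x = (\<Sum>u\<in>V. \<Sum>v\<in>V. a u v * x u * x v)"

definition norm_square :: "'a set \<Rightarrow> ('a \<Rightarrow> real) \<Rightarrow> real" where
  "norm_square V x = (\<Sum>u\<in>V. (x u)\<^sup>2)"

lemma norm_square_nonneg: "0 \<le> norm_square V x"
  unfolding norm_square_def by (simp add: sum_nonneg)

lemma norm_square_eq_0_iff: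
  assumes "finite V"
  shows "norm_square V x = 0 \<longleftrightarrow> (\<forall>v\<in>V. x v = 0)"
  unfolding norm_square_def using assms by (simp add: sum_nonneg_eq_0_iff)

lemma quadratic_form_eigenvector:
  assumes "\<And>v. v \<in> V \<Longrightarrow> (\<Sum>u\<in>V. a v u * x u) = k * x v"
  shows "quadratic_form a V x = k * norm_square V x"
proof -
  have "quadratic_form a V x = (\<Sum>v\<in>V. x v * (\<Sum>u\<in>V. a v u * x u))"
    unfolding quadratic_form_def by (simp add: sum_distrib_left mult_ac)
  also have "\<dots> = (\<Sum>v\<in>V. x v * (k * x v))"
    using assms by simp
  also have "\<dots> = k * norm_square V x"
    unfolding norm_square_def by (simp add: sum_distrib_left power2_eq_square mult_ac)
  finally show ?thesis .
qed

text \<open>First-order condition: a quadratic in \<open>t\<close> that vanishes at 0 and is nowhere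
  positive has derivative 0 there.\<close>

lemma linear_term_eq_0:
  fixes c d :: real
  assumes "\<And>t. 2 * t * c + t\<^sup>2 * d \<le> 0"
  shows "c = 0"
proof -
  \<comment> \<open>With this \<open>t\<close> the linear term equals
    \<open>2 * t\<^sup>2 * (\<bar>d\<bar> + 1)\<close>, which outweighs \<open>t\<^sup>2 * d\<close>
    whatever the sign of \<open>d\<close>.\<close>
  define t where "t = c / (\<bar>d\<bar> + 1)"
  have c: "c = t * (\<bar>d\<bar> + 1)" by (simp add: t_def)
  have "t\<^sup>2 * (2 * (\<bar>d\<bar> + 1) + d) \<le> 0"
    using assms[of t] by (simp add: c power2_eq_square algebra_simps)
  moreover have "2 * (\<bar>d\<bar> + 1) + d > 0" by (simp add: abs_if)
  ultimately have "t\<^sup>2 \<le> 0" by (simp add: mult_le_0_iff)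
  then show ?thesis by (simp add: c)
qed

text \<open>Move \<open>x\<close> by \<open>t\<close> in the single coordinate \<open>v\<close>. The
  change of \<open>quadratic_form - M * norm_square\<close> is a quadratic in \<open>t\<close> that
  is never positive, and its linear coefficient is twice the residual of the eigenvalue equation at
  \<open>v\<close>.\<close>

lemma Rayleigh_maximizer_eigenvector:
  assumes fin: "finite V" and sym: "\<And>u v. a u v = a v u"
    and bound: "\<And>y. quadratic_form a V y \<le> M * norm_square V y"
    and max: "quadratic_form a V x = M * norm_square V x" and v: "v \<in> V"
  shows "(\<Sum>u\<in>V. a v u * x u) = M * x v"
proof -
  let ?s = "\<Sum>u\<in>V. a v u * x u"
  have "2 * t * (?s - M * x v) + t\<^sup>2 * (a v v - M) \<le> 0" for t
  proof -
    define d where "d u = (if u = v then t else 0)" for u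
    have d1: "(\<Sum>u\<in>V. g u * d u) = g v * t" for g :: "'a \<Rightarrow> real"
      unfolding d_def using fin v by (simp add: if_distrib cong: if_cong)
    have d2: "(\<Sum>u\<in>V. d u * g u) = t * g v" for g :: "'a \<Rightarrow> real"
      using d1[of g] by (simp add: mult.commute)
    have "quadratic_form a V (\<lambda>u. x u + d u) = quadratic_form a V x
        + (\<Sum>u\<in>V. \<Sum>w\<in>V. a u w * x u * d w) + (\<Sum>u\<in>V. d u * (\<Sum>w\<in>V. a u w * x w))
        + (\<Sum>u\<in>V. d u * (\<Sum>w\<in>V. a u w * d w))"
      unfolding quadratic_form_def by (simp add: sum_distrib_left sum.distrib algebra_simps)
    also have "(\<Sum>u\<in>V. \<Sum>w\<in>V. a u w * x u * d w) = t * ?s"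
      unfolding d1 sym[of _ v] by (simp add: sum_distrib_left mult_ac)
    also have "(\<Sum>u\<in>V. d u * (\<Sum>w\<in>V. a u w * x w)) = t * ?s"
      by (simp add: d2)
    also have "(\<Sum>u\<in>V. d u * (\<Sum>w\<in>V. a u w * d w)) = t\<^sup>2 * a v v"
      unfolding d1 d2 by (simp add: power2_eq_square)
    finally have Q: "quadratic_form a V (\<lambda>u. x u + d u) =
      quadratic_form a V x + 2 * t * ?s + t\<^sup>2 * a v v" by simp
    have "norm_square V (\<lambda>u. x u + d u) =
        norm_square V x + 2 * (\<Sum>u\<in>V. x u * d u) + (\<Sum>u\<in>V. d u * d u)"
      unfolding norm_square_def
      by (simp add: sum.distrib sum_distrib_left power2_eq_square algebra_simps)
    also have "\<dots> = norm_square V x + 2 * t * x v + t\<^sup>2"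
      by (simp only: d1) (simp add: d_def power2_eq_square mult_ac)
    finally have N: "norm_square V (\<lambda>u. x u + d u) = norm_square V x + 2 * t * x v + t\<^sup>2" .
    show ?thesis using bound[of "\<lambda>u. x u + d u"] unfolding Q N max by (simp add: algebra_simps)
  qed
  from linear_term_eq_0[OF this] show ?thesis by simp
qed

text \<open>The form attains its maximum on the compact unit sphere; homogeneity of degree 2 extends
  the bound to all functions.\<close>

lemma Rayleigh_maximum_exists:
  assumes fin: "finite V" and ne: "V \<noteq> {}"
  obtains M x where "\<exists>v\<in>V. x v \<noteq> 0" "quadratic_form a V x = M * norm_square V x"
    "\<And>y. quadratic_form a V y \<le> M * norm_square V y"
proof -
  \<comment> \<open>Functions on the whole type form a possibly infinite product. Pinning the
    coordinates outside \<open>V\<close> to 0 gives a product of compact sets, compact by Tychonoff,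
    in which the unit sphere \<open>S\<close> is closed.\<close>
  define K where "K = PiE UNIV (\<lambda>u. if u \<in> V then {-1..1::real} else {0})"
  define S where "S = K \<inter> {x. norm_square V x = 1}"
  have cont: "continuous_on T (\<lambda>x :: 'a \<Rightarrow> real. x u)" for T u
    by (rule continuous_on_subset[OF continuous_on_product_coordinates subset_UNIV])
  have contN: "continuous_on UNIV (norm_square V)"
    unfolding norm_square_def by (intro continuous_intros cont)
  have contQ: "continuous_on S (quadratic_form a V)"
    unfolding quadratic_form_def by (intro continuous_intros cont)
  have "compact K"
    unfolding K_def compactin_euclidean_iff[symmetric] euclidean_product_topology[symmetric]
    by (subst compactin_PiE) auto
  moreover have "closed {x. norm_square V x = 1}"
    using closed_Collect_eq[OF contN continuous_on_const] .
  ultimately have "compact S" unfolding S_def by (rule compact_Int_closed)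
  moreover have "S \<noteq> {}"
  proof -
    obtain v where v: "v \<in> V" using ne by blast
    have "norm_square V (\<lambda>u. if u = v then 1 else 0) = 1"
      unfolding norm_square_def using fin v
      by (simp add: if_distrib[of "\<lambda>c :: real. c\<^sup>2"] cong: if_cong)
    then have "(\<lambda>u. if u = v then 1 else 0) \<in> S"
      unfolding S_def K_def using v by auto
    then show ?thesis by blast
  qed
  ultimately obtain x where x: "x \<in> S"
    and max: "\<And>y. y \<in> S \<Longrightarrow> quadratic_form a V y \<le> quadratic_form a V x"
    using continuous_attains_sup[OF _ _ contQ] by blast
  have Nx: "norm_square V x = 1" using x by (simp add: S_def)
  show ?thesis
  proof
    show "\<exists>v\<in>V. x v \<noteq> 0" using Nx norm_square_eq_0_iff[OF fin, of x] by auto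
    show "quadratic_form a V x = quadratic_form a V x * norm_square V x" by (simp add: Nx)
    fix y
    show "quadratic_form a V y \<le> quadratic_form a V x * norm_square V y"
    proof (cases "norm_square V y = 0")
      case True
      then have "quadratic_form a V y = 0"
        by (simp add: norm_square_eq_0_iff[OF fin] quadratic_form_def)
      with True show ?thesis by simp
    next
      case False
      define r where "r = sqrt (norm_square V y)"
      have pos: "norm_square V y > 0" using False norm_square_nonneg[of V y] by linarith
      then have r: "r > 0" "r\<^sup>2 = norm_square V y" by (auto simp: r_def)
      \<comment> \<open>Rescaled to norm 1 and cut off outside \<open>V\<close>, so that
        \<open>z\<close> lies in \<open>S\<close>.\<close>
      define z where "z u = (if u \<in> V then y u / r else 0)" for u
      have "norm_square V z = (\<Sum>u\<in>V. (y u)\<^sup>2 / r\<^sup>2)"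
        unfolding norm_square_def z_def by (simp add: power_divide)
      also have "\<dots> = norm_square V y / r\<^sup>2"
        unfolding norm_square_def by (simp add: sum_divide_distrib)
      finally have Nz: "norm_square V z = 1" using pos r by simp
      have "(z u)\<^sup>2 \<le> 1" if "u \<in> V" for u
        using member_le_sum[OF that _ fin, of "\<lambda>u. (z u)\<^sup>2"] Nz by (simp add: norm_square_def)
      then have "\<bar>z u\<bar> \<le> 1" if "u \<in> V" for u
        using that by (simp add: abs_square_le_1)
      then have "z \<in> S" unfolding S_def K_def using Nz
        by (fastforce simp: z_def abs_le_iff)
      then have "quadratic_form a V z \<le> quadratic_form a V x" by (rule max)
      moreover have "quadratic_form a V z = quadratic_form a V y / r\<^sup>2"
        unfolding quadratic_form_def sum_divide_distrib
        by (intro sum.cong refl) (simp add: z_def power2_eq_square)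
      ultimately show ?thesis using r pos by (simp add: divide_le_eq)
    qed
  qed
qed

section \<open>The spectral radius of a graph\<close>

definition arc_indicator :: "'a pair_pre_digraph \<Rightarrow> 'a \<Rightarrow> 'a \<Rightarrow> real" where
  "arc_indicator G u v = (if (u, v) \<in> parcs G then 1 else 0)"

abbreviation adjacency_form :: "'a pair_pre_digraph \<Rightarrow> ('a \<Rightarrow> real) \<Rightarrow> real" where
  "adjacency_form G \<equiv> quadratic_form (arc_indicator G) (pverts G)"

lemma (in pair_graph) arc_indicator_sym: "arc_indicator G u v = arc_indicator G v u"
  using arcs_symmetric by (auto simp: arc_indicator_def)

text \<open>The characteristic polynomial is monic, hence has finitely many roots. This gives the
  \<open>Max\<close> in \<open>graph_spectral_radius\<close> its intended meaning.\<close>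

lemma finite_eigenvalues:
  assumes "A \<in> carrier_mat n n"
  shows "finite {k :: real. eigenvalue A k}"
proof -
  have "char_poly A \<noteq> 0" using degree_monic_char_poly[OF assms] by auto
  then show ?thesis using poly_roots_finite eigenvalue_root_char_poly[OF assms] by simp
qed

text \<open>The spectral radius is the maximal Rayleigh quotient: a maximizer is an eigenvector for
  the maximum \<open>M\<close>, and every eigenvalue is the Rayleigh quotient of its eigenvector, so
  at most \<open>M\<close>.\<close>

lemma (in pair_graph)
  assumes ne: "pverts G \<noteq> {}"
  shows adjacency_form_le:
      "adjacency_form G y \<le> graph_spectral_radius G * norm_square (pverts G) y" (is ?le)
    and spectral_radius_attained:
      "\<exists>x. (\<exists>v\<in>pverts G. x v \<noteq> 0) \<and>
        adjacency_form G x = graph_spectral_radius G * norm_square (pverts G) x" (is ?attained)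
proof -
  let ?V = "pverts G" and ?a = "arc_indicator G" and ?vs = "vertex_list (pverts G)"
  note fin = pair_finite_verts
  obtain M x where x: "\<exists>v\<in>?V. x v \<noteq> 0" "adjacency_form G x = M * norm_square ?V x"
    and bound: "\<And>y. adjacency_form G y \<le> M * norm_square ?V y"
    by (rule Rayleigh_maximum_exists[OF fin ne, of ?a]) (rule that)
  have ev: "eigenvalue (adjacency_matrix G ?vs) k \<longleftrightarrow>
      (\<exists>x. (\<exists>v\<in>?V. x v \<noteq> 0) \<and> (\<forall>v\<in>?V. (\<Sum>u\<in>?V. ?a v u * x u) = k * x v))" for k
    unfolding eigenvalue_adjacency_matrix_iff[OF vertex_list(1)[OF fin]] vertex_list(2)[OF fin]
    by (simp add: arc_indicator_def if_distrib[of "\<lambda>c. c * _"] cong: if_cong)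
  have "graph_spectral_radius G = M"
    unfolding graph_spectral_radius_def
  proof (rule Max_eqI)
    show "finite {k. eigenvalue (adjacency_matrix G ?vs) k}"
      by (rule finite_eigenvalues[where n = "length ?vs"]) (simp add: adjacency_matrix_def)
    show "M \<in> {k. eigenvalue (adjacency_matrix G ?vs) k}"
      using x Rayleigh_maximizer_eigenvector[OF fin arc_indicator_sym bound x(2)] ev by blast
    fix k assume "k \<in> {k. eigenvalue (adjacency_matrix G ?vs) k}"
    then obtain y where y: "\<exists>v\<in>?V. y v \<noteq> 0" "\<And>v. v \<in> ?V \<Longrightarrow> (\<Sum>u\<in>?V. ?a v u * y u) = k * y v"
      using ev by auto
    have "k * norm_square ?V y \<le> M * norm_square ?V y"
      using quadratic_form_eigenvector[of ?V ?a y k] y(2) bound[of y] by simp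
    moreover have "norm_square ?V y > 0"
      using norm_square_nonneg[of ?V y] norm_square_eq_0_iff[OF fin, of y] y(1) by fastforce
    ultimately show "k \<le> M" by simp
  qed
  then show ?le ?attained using bound x by auto
qed

text \<open>Connectedness is defined through the symmetric closure, which leaves reachability
  unchanged because the arcs are already symmetric.\<close>

lemma (in pair_graph) connected_iff_rtrancl:
  "Digraph_Component.connected (with_proj G) \<longleftrightarrow>
    pverts G \<noteq> {} \<and> (\<forall>u\<in>pverts G. \<forall>v\<in>pverts G. (u, v) \<in> (parcs G)\<^sup>*)"
proof -
  have "symmetric (with_proj G)" by (rule pair_sym_arcs)
  then have "u \<rightarrow>\<^sup>*\<^bsub>mk_symmetric (with_proj G)\<^esub> v \<longleftrightarrow>
      (u, v) \<in> (parcs G)\<^sup>* \<and> u \<in> pverts G \<and> v \<in> pverts G" for u v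
    using reachable_mk_symmetric_eq[of u v] reachable_conv[of u v] by simp
  then show ?thesis
    unfolding Digraph_Component.connected_def strongly_connected_def by auto
qed

text \<open>Zeros spread: where \<open>y\<close> vanishes, the sum over the neighbours is 0 with
  nonnegative terms, so all neighbours vanish too. By connectedness \<open>y\<close> would be 0
  everywhere.\<close>

lemma (in pair_graph) nonneg_eigenvector_pos:
  assumes conn: "Digraph_Component.connected (with_proj G)"
    and nonneg: "\<And>v. 0 \<le> y v"
    and eig: "\<And>v. v \<in> pverts G \<Longrightarrow> (\<Sum>u\<in>pverts G. arc_indicator G v u * y u) = k * y v"
    and nz: "\<exists>v\<in>pverts G. y v \<noteq> 0" and v: "v \<in> pverts G"
  shows "0 < y v"
proof (rule ccontr)
  assume "\<not> 0 < y v"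
  then have yv: "y v = 0" using nonneg[of v] by linarith
  have step: "y w = 0" if "y u = 0" "(u, w) \<in> parcs G" for u w
  proof -
    have "(\<Sum>w\<in>pverts G. arc_indicator G u w * y w) = 0"
      using eig[of u] that in_arcsD1 by simp
    then have "\<forall>w\<in>pverts G. arc_indicator G u w * y w = 0"
      using pair_finite_verts nonneg
      by (subst (asm) sum_nonneg_eq_0_iff) (auto simp: arc_indicator_def)
    then show ?thesis using that in_arcsD2[OF that(2)] by (auto simp: arc_indicator_def)
  qed
  have "y w = 0" if "(v, w) \<in> (parcs G)\<^sup>*" for w
    using that by (induction rule: rtrancl_induct) (use yv step in blast)+
  then show False using nz v conn by (auto simp: connected_iff_rtrancl)
qed

section \<open>Deleting an edge\<close>

definition delete_edge :: "'a pair_pre_digraph \<Rightarrow> 'a \<Rightarrow> 'a \<Rightarrow> 'a pair_pre_digraph" where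
  "delete_edge G u v = \<lparr>pverts = pverts G, parcs = parcs G - {(u, v), (v, u)}\<rparr>"

lemma delete_edge_simps [simp]:
  "pverts (delete_edge G u v) = pverts G"
  "parcs (delete_edge G u v) = parcs G - {(u, v), (v, u)}"
  by (simp_all add: delete_edge_def)

lemma (in pair_graph) pair_graph_delete_edge: "pair_graph (delete_edge G u v)"
  using in_arcsD1 in_arcsD2 pair_finite_verts pair_finite_arcs pair_no_loops arcs_symmetric
  by unfold_locales (auto simp: symmetric_def sym_def)

text \<open>A maximizer for the smaller graph may be taken nonnegative. If the spectral radius did not
  drop, it would be a Perron vector of the larger graph, so positive at both ends of the edge.\<close>

lemma (in pair_graph) spectral_radius_delete_edge_less:
  assumes conn: "Digraph_Component.connected (with_proj G)" and e: "(u, v) \<in> parcs G"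
  shows "graph_spectral_radius (delete_edge G u v) < graph_spectral_radius G"
proof (rule ccontr)
  let ?H = "delete_edge G u v" and ?V = "pverts G"
  assume "\<not> ?thesis"
  then have le: "graph_spectral_radius G \<le> graph_spectral_radius ?H" by simp
  interpret H: pair_graph ?H by (rule pair_graph_delete_edge)
  have V: "u \<in> ?V" "v \<in> ?V" using e in_arcsD1 in_arcsD2 by auto
  then have ne: "?V \<noteq> {}" by blast
  obtain x where x: "\<exists>v\<in>?V. x v \<noteq> 0"
    "adjacency_form ?H x = graph_spectral_radius ?H * norm_square ?V x"
    using H.spectral_radius_attained ne by auto
  define y where "y w = \<bar>x w\<bar>" for w
  have Ny: "norm_square ?V y = norm_square ?V x" by (simp add: norm_square_def y_def)
  \<comment> \<open>The matrix entries are nonnegative, so passing to absolute values cannot lower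
    the form.\<close>
  have Hy: "adjacency_form ?H x \<le> adjacency_form ?H y"
    unfolding quadratic_form_def y_def
    by (intro sum_mono) (auto simp: arc_indicator_def abs_mult[symmetric])
  have step: "arc_indicator ?H a b * y a * y b \<le> arc_indicator G a b * y a * y b" for a b
    by (auto simp: arc_indicator_def y_def)
  have "adjacency_form ?H y < adjacency_form G y" if "0 < y u * y v"
    unfolding quadratic_form_def delete_edge_simps
  proof (rule sum_strict_mono_ex1)
    show "\<exists>a\<in>?V. (\<Sum>b\<in>?V. arc_indicator ?H a b * y a * y b) <
        (\<Sum>b\<in>?V. arc_indicator G a b * y a * y b)"
    proof (rule bexI[OF _ V(1)], rule sum_strict_mono_ex1)
      show "\<exists>b\<in>?V. arc_indicator ?H u b * y u * y b < arc_indicator G u b * y u * y b"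
        using V that e by (intro bexI[of _ v]) (auto simp: arc_indicator_def)
    qed (use step pair_finite_verts in auto)
  qed (use step pair_finite_verts in \<open>auto intro: sum_mono\<close>)
  moreover have HG: "adjacency_form ?H y \<le> adjacency_form G y"
    unfolding quadratic_form_def delete_edge_simps by (intro sum_mono step)
  moreover have Gy: "adjacency_form G y \<le> graph_spectral_radius G * norm_square ?V y"
    by (rule adjacency_form_le[OF ne])
  moreover have "graph_spectral_radius G * norm_square ?V y
      \<le> graph_spectral_radius ?H * norm_square ?V y"
    using le norm_square_nonneg by (rule mult_right_mono)
  \<comment> \<open>The inequalities chain from
    \<open>graph_spectral_radius ?H * norm_square ?V y\<close> back to itself, so all are
    equalities; a positive product \<open>y u * y v\<close> would make one of them strict.\<close>
  ultimately have eq: "adjacency_form G y = graph_spectral_radius G * norm_square ?V y"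
    and not_pos: "\<not> 0 < y u * y v"
    using Hy x(2) Ny by auto
  have "0 < y w" if "w \<in> ?V" for w
  proof (rule nonneg_eigenvector_pos[OF conn _ _ _ that])
    show "(\<Sum>b\<in>?V. arc_indicator G a b * y b) = graph_spectral_radius G * y a" if "a \<in> ?V" for a
      using Rayleigh_maximizer_eigenvector[OF pair_finite_verts arc_indicator_sym
          adjacency_form_le[OF ne] eq that] .
  qed (use x(1) in \<open>auto simp: y_def\<close>)
  then show False using V not_pos by simp
qed

section \<open>Cycles\<close>

lemma pcas_append: "pcas u (p @ q) v \<longleftrightarrow> (\<exists>w. pcas u p w \<and> pcas w q v)"
  by (induction p arbitrary: u) auto

lemma pcas_tails_heads: "pcas u p v \<Longrightarrow> map fst p @ [v] = u # map snd p"
  by (induction p arbitrary: u) auto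

lemma pawalk_verts_eq_heads: "pcas u p v \<Longrightarrow> pawalk_verts u p = u # map snd p"
  by (induction p arbitrary: u) auto

lemma pcas_rtrancl: "pcas u p v \<Longrightarrow> set p \<subseteq> R \<Longrightarrow> (u, v) \<in> R\<^sup>*"
  by (induction p arbitrary: u) (auto intro: converse_rtrancl_into_rtrancl)

text \<open>A closed walk leaves each vertex as often as it enters it. This carries distinctness of
  the heads over to the tails.\<close>

lemma pcas_closed_tails_heads:
  assumes "pcas u p u"
  shows "mset (map fst p) = mset (map snd p)"
  using arg_cong[OF pcas_tails_heads[OF assms], of mset] by simp

lemma pcas_cycle_rotate:
  assumes "pcas u (p @ e # q) u"
  shows "pcas (snd e) (q @ p) (fst e)"
  using assms by (auto simp: pcas_append)

text \<open>Without \<open>(x, y)\<close> the cycle is a walk from \<open>y\<close> to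
  \<open>x\<close>. An arc \<open>(y, x)\<close> on it would split off closed walks at
  \<open>y\<close> and at \<open>x\<close>; both are empty since no vertex repeats, which leaves a
  cycle of length 2.\<close>

lemma long_cycle_no_reverse_arc:
  assumes cas: "pcas u p u" and dist: "distinct (map snd p)" and len: "3 \<le> length p"
    and e: "(x, y) \<in> set p"
  shows "(y, x) \<notin> set p"
proof
  assume rev: "(y, x) \<in> set p"
  have dist': "distinct (map fst p)"
    using dist pcas_closed_tails_heads[OF cas] mset_eq_imp_distinct_iff by blast
  obtain p1 p2 where p: "p = p1 @ (x, y) # p2" using e by (meson split_list)
  have cas': "pcas y (p2 @ p1) x" using pcas_cycle_rotate[of u p1 "(x, y)" p2] cas p by simp
  have "p2 @ p1 \<noteq> []" using len p by auto
  then have "y \<in> fst ` set (p2 @ p1)" using cas'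
    by (cases "p2 @ p1") (auto simp del: set_append)
  \<comment> \<open>For a loop, \<open>x\<close> would be the tail of a second arc, the first of the
    remaining walk.\<close>
  then have "x \<noteq> y" using dist' p by auto
  then have "(y, x) \<in> set (p2 @ p1)" using rev p by auto
  then obtain q1 q2 where q: "p2 @ p1 = q1 @ (y, x) # q2" by (meson split_list)
  have d: "distinct (map fst (q1 @ (y, x) # q2))" "distinct (map snd (q1 @ (y, x) # q2))"
    using dist dist' unfolding q[symmetric] p by auto
  have cas'': "pcas y q1 y" "pcas x q2 x" using cas' unfolding q by (auto simp: pcas_append)
  \<comment> \<open>A nonempty \<open>q1\<close> begins with an arc of tail \<open>y\<close>, but
    \<open>(y, x)\<close> has that tail already.\<close>
  have "q1 = []" using cas''(1) d(1) by (cases q1) auto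
  moreover have "q2 = []"
  proof (rule ccontr)
    assume "q2 \<noteq> []"
    then have "x \<in> set (map fst q2)" using cas''(2) by (cases q2) auto
    then have "x \<in> set (map snd q2)"
      using pcas_closed_tails_heads[OF cas''(2)] mset_eq_setD by blast
    then show False using d(2) by auto
  qed
  ultimately have "length (p2 @ p1) = 1" using q by simp
  then show False using len p by simp
qed

text \<open>The rest of the cycle leads from \<open>y\<close> back to \<open>x\<close>. It avoids
  \<open>(x, y)\<close> because heads are distinct, and \<open>(y, x)\<close> because long cycles
  contain no reverse arcs.\<close>

lemma long_cycle_bypass:
  assumes cas: "pcas u p u" and dist: "distinct (map snd p)" and len: "3 \<le> length p"
    and e: "(x, y) \<in> set p"
  shows "(y, x) \<in> (set p - {(x, y), (y, x)})\<^sup>*"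
proof -
  obtain p1 p2 where p: "p = p1 @ (x, y) # p2" using e by (meson split_list)
  have "pcas y (p2 @ p1) x" using pcas_cycle_rotate[of u p1 "(x, y)" p2] cas p by simp
  moreover have "(x, y) \<notin> set (p2 @ p1)" using dist p by (auto simp: rev_image_eqI)
  then have "set (p2 @ p1) \<subseteq> set p - {(x, y), (y, x)}"
    using long_cycle_no_reverse_arc[OF assms] p by auto
  ultimately show ?thesis by (rule pcas_rtrancl)
qed

text \<open>In any walk the deleted edge can be replaced by the bypass or its reversal.\<close>

lemma (in pair_graph) connected_delete_edge:
  assumes conn: "Digraph_Component.connected (with_proj G)"
    and bypass: "(v, u) \<in> (parcs (delete_edge G u v))\<^sup>*"
  shows "Digraph_Component.connected (with_proj (delete_edge G u v))"
proof -
  let ?H = "delete_edge G u v"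
  interpret H: pair_graph ?H by (rule pair_graph_delete_edge)
  have "sym ((parcs ?H)\<^sup>*)" using H.arcs_symmetric by (intro sym_rtrancl symI)
  then have "(u, v) \<in> (parcs ?H)\<^sup>*" using bypass by (rule symD)
  then have "parcs G \<subseteq> (parcs ?H)\<^sup>*" using bypass by auto
  then have "(parcs G)\<^sup>* \<subseteq> (parcs ?H)\<^sup>*" by (rule rtrancl_subset_rtrancl)
  then show ?thesis using conn unfolding H.connected_iff_rtrancl connected_iff_rtrancl by auto
qed

section \<open>Domination\<close>

lemma finite_dominating_sets: "finite (pverts G) \<Longrightarrow> finite {D. dominating_set G D}"
  by (rule finite_subset[of _ "Pow (pverts G)"]) (auto simp: dominating_set_def)

lemma minimum_dominating_set:
  assumes "finite (pverts G)"
  obtains D where "dominating_set G D" "card D = domination_number G"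
proof -
  have "dominating_set G (pverts G)" by (simp add: dominating_set_def)
  then have "domination_number G \<in> card ` {D. dominating_set G D}"
    unfolding domination_number_def using finite_dominating_sets[OF assms] by (intro Min_in) auto
  then show ?thesis using that by auto
qed

lemma domination_number_le:
  assumes "finite (pverts G)" "dominating_set G D"
  shows "domination_number G \<le> card D"
  unfolding domination_number_def using assms finite_dominating_sets by (intro Min_le) auto

text \<open>Deletion creates no new dominating sets, so the number cannot drop; the surviving
  minimum set \<open>D\<close> keeps it from rising.\<close>

lemma domination_number_delete_edge:
  assumes fin: "finite (pverts G)"
    and D: "dominating_set (delete_edge G u v) D" "card D = domination_number G"
  shows "domination_number (delete_edge G u v) = domination_number G"
proof (rule antisym)
  show "domination_number (delete_edge G u v) \<le> domination_number G"
    using domination_number_le[OF _ D(1)] fin D(2) by simp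
  obtain E where E: "dominating_set (delete_edge G u v) E"
    "card E = domination_number (delete_edge G u v)"
    using minimum_dominating_set[of "delete_edge G u v"] fin by auto
  then have "dominating_set G E" by (auto simp: dominating_set_def)
  then show "domination_number G \<le> domination_number (delete_edge G u v)"
    using domination_number_le[OF fin] E(2) by metis
qed

text \<open>On a cycle inside the star forest \<open>F\<close>, both arcs at a vertex outside \<open>D\<close> would join it to the
  same centre.\<close>

lemma long_cycle_edge_not_needed_for_domination:
  assumes cas: "pcas u p u" and dist: "distinct (map snd p)" and len: "3 \<le> length p"
    and p: "set p \<subseteq> parcs G" and wf: "pair_graph G" and D: "dominating_set G D"
  obtains x y where "(x, y) \<in> set p" "dominating_set (delete_edge G x y) D"
proof -
  interpret pair_graph G by fact
  obtain f where f: "f v \<in> D" "(f v, v) \<in> parcs G" if "v \<in> pverts G - D" for v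
    using D unfolding dominating_set_def by metis
  \<comment> \<open>The star edges in both orientations, with \<open>f v\<close> the chosen centre
    for \<open>v\<close>.\<close>
  define F where "F = {(x, y). x \<in> pverts G - D \<and> y = f x \<or> y \<in> pverts G - D \<and> x = f y}"
  have "\<not> set p \<subseteq> F"
  proof
    assume F: "set p \<subseteq> F"
    have ends: "fst ` set p = snd ` set p"
      using mset_eq_setD[OF pcas_closed_tails_heads[OF cas]] by simp
    have "hd p \<in> set p" using len by (cases p) auto
    then obtain a b where ab: "(a, b) \<in> set p" by (metis surj_pair)
    then have "a \<in> snd ` set p" "b \<in> fst ` set p"
      using ends by (auto simp: rev_image_eqI)
    \<comment> \<open>Each star edge has an end outside \<open>D\<close>, and the cycle both enters
      and leaves that vertex.\<close>
    moreover have "a \<in> pverts G - D \<or> b \<in> pverts G - D" using ab F by (auto simp: F_def)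
    ultimately obtain v x y where v: "v \<in> pverts G - D" "(x, v) \<in> set p" "(v, y) \<in> set p"
      using ab by fastforce
    then have "(x, v) \<in> F" "(v, y) \<in> F" using F by auto
    \<comment> \<open>Since \<open>v\<close> is outside \<open>D\<close> it is no centre, so both
      arcs join it to its own centre and are reverse to each other.\<close>
    then have "x = f v" "y = f v" using v(1) f(1) by (auto simp: F_def)
    then show False using long_cycle_no_reverse_arc[OF cas dist len v(2)] v(3) by simp
  qed
  then obtain x y where xy: "(x, y) \<in> set p" "(x, y) \<notin> F" by auto
  have "dominating_set (delete_edge G x y) D"
    unfolding dominating_set_def
  proof (intro conjI ballI)
    show "D \<subseteq> pverts (delete_edge G x y)" using D by (simp add: dominating_set_def)
    fix v assume v: "v \<in> pverts (delete_edge G x y) - D"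
    then have "(f v, v) \<in> parcs (delete_edge G x y)"
      using f(2) xy(2) by (auto simp: F_def)
    then show "\<exists>w\<in>D. (w, v) \<in> parcs (delete_edge G x y)" using f(1) v by auto
  qed
  with xy(1) show ?thesis using that by blast
qed

section \<open>Minimality of the spectral radius excludes long cycles\<close>

theorem theorem2p3:
  fixes n \<gamma> :: nat and G :: "'a pair_pre_digraph"
  assumes "n \<ge> 1" and "\<gamma> \<ge> 1"
    and "(connected_graphs n \<gamma> :: 'a pair_pre_digraph set) \<noteq> {}"
    and "G \<in> connected_graphs n \<gamma>"
    and "\<forall>H \<in> (connected_graphs n \<gamma> :: 'a pair_pre_digraph set).
           graph_spectral_radius G \<le> graph_spectral_radius H"
  shows "undirected_tree G"
proof -
  have G: "pair_graph G" "Digraph_Component.connected (with_proj G)"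
    "card (pverts G) = n" "domination_number G = \<gamma>"
    using assms(4) by (auto simp: connected_graphs_def)
  interpret pair_graph G by fact
  have False if cyc: "pre_digraph.cycle (with_proj G) p" and len: "3 \<le> length p" for p
  proof -
    obtain u where cas: "pcas u p u" and p: "set p \<subseteq> parcs G"
      and "distinct (tl (pawalk_verts u p))"
      using cyc unfolding cycle_def awalk_def by auto
    \<comment> \<open>\<open>pawalk_verts u p\<close> is \<open>u\<close> followed by the heads, so
      dropping the repeated start vertex leaves exactly the heads.\<close>
    then have dist: "distinct (map snd p)" by (simp add: pawalk_verts_eq_heads)
    obtain D where D: "dominating_set G D" "card D = domination_number G"
      using minimum_dominating_set[OF pair_finite_verts] .
    obtain x y where xy: "(x, y) \<in> set p" and dom: "dominating_set (delete_edge G x y) D"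
      using long_cycle_edge_not_needed_for_domination[OF cas dist len p G(1) D(1)] .
    have "(y, x) \<in> (parcs (delete_edge G x y))\<^sup>*"
      using long_cycle_bypass[OF cas dist len xy] p
        rtrancl_mono[of "set p - {(x, y), (y, x)}" "parcs (delete_edge G x y)"] by auto
    \<comment> \<open>The bypass keeps the graph connected and \<open>D\<close> keeps its domination
      number, so it competes with \<open>G\<close>.\<close>
    then have "delete_edge G x y \<in> connected_graphs n \<gamma>"
      using connected_delete_edge[OF G(2)] pair_graph_delete_edge G
        domination_number_delete_edge[OF pair_finite_verts dom D(2)]
      by (simp add: connected_graphs_def)
    then have "graph_spectral_radius G \<le> graph_spectral_radius (delete_edge G x y)"
      using assms(5) by blast
    moreover have "(x, y) \<in> parcs G" using xy p by blast
    ultimately show False using spectral_radius_delete_edge_less[OF G(2)] by fastforce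
  qed
  then show ?thesis unfolding undirected_tree_def using G(2) by blast
qed

end
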